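(* Let $u,w\in S_\infty$, let $\lambda$ be a partition, and suppose $P\in\mathrm{Path}_\lambda(u,w)$. Then $\mathrm{weight}_{P,\lambda}(y;y)$ is Graham-nonnegative.
   Context: **Permutations.** $\mathbb{N}=\{1,2,3,\dots\}$. $S_\infty$ is the group of bijections $\mathbb{N}\to\mathbb{N}$ fixing all but finitely many elements, with product $(uv)(i)=u(v(i))$. $t_{ab}=t_{ba}$ ($a\ne b$) is the transposition of $a$ and $b$. $\ell(u)$ is the number of pairs $i<j$ with $u(i)>u(j)$. **The relation $\xrightarrow{k}$ and weights.** For $u,u'\in S_\infty$ and a positive integer $k$, write $u\xrightarrow{k}u'$ if there exist $p$ with $0\le p\le k$ and transpositions $t_{a_1b_1},\dots,t_{a_pb_p}$ such that (1) $a_i\le k<b_i$ for all $i$; (2) $a_i\ne a_j$ for $i\neq j$; (3) $\ell(ut_{a_1b_1}\cdots t_{a_ib_i})=\ell(u)+i$ for all $i$; (4) $u'=ut_{a_1b_1}\cdots t_{a_pb_p}$. If $u\xrightarrow{k}w$, let $P_k(u,w)=\{u(i)\mid i\le k,\ u(i)=w(i)\}$ and $\mathrm{weight}_{u,k}^w(y;z_j)=\prod_{i\in P_k(u,w)}(y_i-z_j)$ (empty product $=1$), where $y_i,z_i$ ($i\in\mathbb{N}$) are indeterminates. For a partition $\lambda=(\lambda_1\ge\dots\ge\lambda_m>0)$ of length $m$, $\mathrm{Path}_\lambda(u,w)$ is the set of sequences $(u_0,\dots,u_m)$ in $S_\infty$ with $u=u_0\xrightarrow{\lambda_1}u_1\xrightarrow{\lambda_2}\cdots\xrightarrow{\lambda_m}u_m=w$,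 and for such a path $P$, $\mathrm{weight}_{P,\lambda}(y;z)=\prod_{i=1}^m\mathrm{weight}_{u_{i-1},\lambda_i}^{u_i}(y;z_i)$. $\mathrm{weight}_{P,\lambda}(y;y)$ is the result of substituting $z_i=y_i$ for all $i$. **Graham-nonnegative.** A polynomial in the $y_i$ is Graham-nonnegative if it can be expressed as a polynomial with nonnegative integer coefficients in the simple negative roots $\alpha_i=y_{i+1}-y_i$ ($i\ge1$). (The zero polynomial is Graham-nonnegative.) *)

theory Defs
  imports "HOL-Combinatorics.Permutations" "HOL-Library.Poly_Mapping"
begin

text \<open>The natural numbers of the paper start at 1: finitary permutations are functions on
  \<^typ>\<open>nat\<close> that permute \<open>{1..}\<close> (and hence fix the junk value 0).  The group product
  is function composition.\<close>

definition S_inf :: "(nat \<Rightarrow> nat) set" where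
  "S_inf = {u. u permutes {1..} \<and> finite {i. u i \<noteq> i}}"

definition perm_len :: "(nat \<Rightarrow> nat) \<Rightarrow> nat" where
  "perm_len u = card {(i, j). 1 \<le> i \<and> i < j \<and> u i > u j}"

text \<open>\<open>u t_{a_1 b_1} \<dots> t_{a_p b_p}\<close> for the list \<open>[(a_1, b_1), \<dots>, (a_p, b_p)]\<close>.\<close>

definition mult_transps :: "(nat \<Rightarrow> nat) \<Rightarrow> (nat \<times> nat) list \<Rightarrow> (nat \<Rightarrow> nat)" where
  "mult_transps u ts = foldl (\<lambda>v (a, b). v \<circ> transpose a b) u ts"

definition arrow :: "nat \<Rightarrow> (nat \<Rightarrow> nat) \<Rightarrow> (nat \<Rightarrow> nat) \<Rightarrow> bool" where
  "arrow k u u' \<longleftrightarrow> u \<in> S_inf \<and> u' \<in> S_inf \<and>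
     (\<exists>ts. length ts \<le> k \<and>
        (\<forall>(a, b) \<in> set ts. 1 \<le> a \<and> a \<le> k \<and> k < b) \<and>
        distinct (map fst ts) \<and>
        (\<forall>i \<in> {1..length ts}. perm_len (mult_transps u (take i ts)) = perm_len u + i) \<and>
        u' = mult_transps u ts)"

text \<open>A partition is the list of its (positive) parts in weakly decreasing order;
  its length is the length of the list.\<close>

definition is_partition :: "nat list \<Rightarrow> bool" where
  "is_partition lam \<longleftrightarrow> sorted_wrt (\<ge>) lam \<and> (\<forall>x \<in> set lam. 0 < x)"

text \<open>Lists are indexed from 0, so the part written \<open>\<lambda>_i\<close> in the mathematics is
  \<open>lam ! (i - 1)\<close>, whereas \<open>u_i\<close> is \<open>us ! i\<close>.\<close>

definition Path :: "nat list \<Rightarrow> (nat \<Rightarrow> nat) \<Rightarrow> (nat \<Rightarrow> nat) \<Rightarrow> (nat \<Rightarrow> nat) list set" where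
  "Path lam u w = {us. length us = length lam + 1 \<and> set us \<subseteq> S_inf \<and>
     us ! 0 = u \<and> us ! length lam = w \<and>
     (\<forall>i \<in> {1..length lam}. arrow (lam ! (i - 1)) (us ! (i - 1)) (us ! i))}"

text \<open>Polynomials with integer coefficients in indeterminates indexed by \<open>'v\<close>:
  finitely supported maps from monomials (finitely supported exponent functions) to
  coefficients, with the convolution product of \<^theory>\<open>HOL-Library.Poly_Mapping\<close>.\<close>

type_synonym 'v ipoly = "('v \<Rightarrow>\<^sub>0 nat) \<Rightarrow>\<^sub>0 int"

definition Var :: "'v \<Rightarrow> 'v ipoly" where
  "Var v = Poly_Mapping.single (Poly_Mapping.single v 1) 1"

definition poly_subst :: "('v \<Rightarrow> 'w ipoly) \<Rightarrow> 'v ipoly \<Rightarrow> 'w ipoly" where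
  "poly_subst f p =
     (\<Sum>m \<in> Poly_Mapping.keys p. of_int (Poly_Mapping.lookup p m) *
        (\<Prod>v \<in> Poly_Mapping.keys m. f v ^ Poly_Mapping.lookup m v))"

datatype yz = Y nat | Z nat

definition P_set :: "nat \<Rightarrow> (nat \<Rightarrow> nat) \<Rightarrow> (nat \<Rightarrow> nat) \<Rightarrow> nat set" where
  "P_set k u w = {u i | i. 1 \<le> i \<and> i \<le> k \<and> u i = w i}"

text \<open>\<open>step_weight k u w j\<close> is \<open>weight_{u,k}^w(y; z_j)\<close>.\<close>

definition step_weight :: "nat \<Rightarrow> (nat \<Rightarrow> nat) \<Rightarrow> (nat \<Rightarrow> nat) \<Rightarrow> nat \<Rightarrow> yz ipoly" where
  "step_weight k u w j = (\<Prod>i \<in> P_set k u w. Var (Y i) - Var (Z j))"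

definition path_weight :: "nat list \<Rightarrow> (nat \<Rightarrow> nat) list \<Rightarrow> yz ipoly" where
  "path_weight lam us =
     (\<Prod>i = 1..length lam. step_weight (lam ! (i - 1)) (us ! (i - 1)) (us ! i) i)"

text \<open>The substitution \<open>z_i = y_i\<close>; its result is a polynomial in the \<open>y_i\<close> alone,
  which are indexed by \<^typ>\<open>nat\<close>.\<close>

definition subst_z_y :: "yz ipoly \<Rightarrow> nat ipoly" where
  "subst_z_y = poly_subst (\<lambda>v. case v of Y i \<Rightarrow> Var i | Z i \<Rightarrow> Var i)"

definition neg_root :: "nat \<Rightarrow> nat ipoly" where
  "neg_root i = Var (i + 1) - Var i"

text \<open>In \<open>Q\<close> the indeterminate with index \<open>i\<close> stands for the negative root with index
  \<open>i\<close>; only indices \<open>i \<ge> 1\<close> may occur.\<close>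

definition Graham_nonneg :: "nat ipoly \<Rightarrow> bool" where
  "Graham_nonneg p \<longleftrightarrow>
     (\<exists>Q :: nat ipoly.
        (\<forall>m. Poly_Mapping.lookup Q m \<ge> 0) \<and>
        (\<forall>m \<in> Poly_Mapping.keys Q. Poly_Mapping.keys m \<subseteq> {1..}) \<and>
        p = poly_subst neg_root Q)"

end

theory Submission
  imports Defs
begin

text \<open>Along a step of index \<open>k\<close> the values at positions \<open>i \<le> k\<close> weakly increase, because every
  transposition lengthens the permutation. As \<open>\<lambda>\<close> is weakly decreasing, the value at a position
  \<open>i \<le> \<lambda>\<^sub>j\<close> therefore weakly increases during the steps \<open>1, \<dots>, j\<close>. Suppose a factor \<open>y\<^sub>a - y\<^sub>j\<close>
  with \<open>a < j\<close> comes from position \<open>i\<close> in step \<open>j\<close>. The values \<open>v\<^sub>0 \<le> v\<^sub>1 \<le> \<dots>\<close> at \<open>i\<close> start at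
  \<open>v\<^sub>0 \<ge> 1\<close> and satisfy \<open>v\<^sub>j \<le> j\<close>, so at the first index \<open>s\<close> with \<open>v\<^sub>s \<le> s\<close> they satisfy
  \<open>v\<^bsub>s-1\<^esub> = v\<^sub>s = s\<close>, and step \<open>s\<close> contributes the factor \<open>y\<^sub>s - y\<^sub>s = 0\<close>. Hence the weight either
  vanishes or is a product of sums of simple negative roots.\<close>

subsection \<open>Substitution as a ring homomorphism\<close>

definition monom_subst :: "('v \<Rightarrow> 'w ipoly) \<Rightarrow> ('v \<Rightarrow>\<^sub>0 nat) \<Rightarrow> 'w ipoly" where
  "monom_subst f m = (\<Prod>v \<in> Poly_Mapping.keys m. f v ^ Poly_Mapping.lookup m v)"

text \<open>Extra indices contribute \<open>f v ^ 0 = 1\<close>. This lets monomials with different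
  supports be evaluated over one common index set, which is what additivity in the exponent
  requires.\<close>

lemma monom_subst_superset:
  assumes "finite A" and "Poly_Mapping.keys m \<subseteq> A"
  shows "monom_subst f m = (\<Prod>v \<in> A. f v ^ Poly_Mapping.lookup m v)"
  unfolding monom_subst_def
  by (rule prod.mono_neutral_left) (use assms in \<open>auto simp: in_keys_iff\<close>)

lemma monom_subst_add: "monom_subst f (m + n) = monom_subst f m * monom_subst f n"
proof -
  let ?A = "Poly_Mapping.keys m \<union> Poly_Mapping.keys n"
  have "monom_subst f (m + n) = (\<Prod>v \<in> ?A. f v ^ Poly_Mapping.lookup (m + n) v)"
    by (rule monom_subst_superset) (use Poly_Mapping.keys_add[of m n] in auto)
  also have "\<dots> = (\<Prod>v \<in> ?A. f v ^ Poly_Mapping.lookup m v) * (\<Prod>v \<in> ?A. f v ^ Poly_Mapping.lookup n v)"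
    by (simp add: lookup_add power_add prod.distrib)
  also have "\<dots> = monom_subst f m * monom_subst f n"
    by (simp add: monom_subst_superset[of ?A])
  finally show ?thesis .
qed

lemma poly_subst_superset:
  assumes "finite A" and "Poly_Mapping.keys p \<subseteq> A"
  shows "poly_subst f p = (\<Sum>m \<in> A. of_int (Poly_Mapping.lookup p m) * monom_subst f m)"
  unfolding poly_subst_def monom_subst_def[symmetric]
  by (rule sum.mono_neutral_left) (use assms in \<open>auto simp: in_keys_iff\<close>)

lemma poly_subst_add: "poly_subst f (p + q) = poly_subst f p + poly_subst f q"
proof -
  let ?A = "Poly_Mapping.keys p \<union> Poly_Mapping.keys q"
  have "poly_subst f (p + q) =
      (\<Sum>m \<in> ?A. of_int (Poly_Mapping.lookup (p + q) m) * monom_subst f m)"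
    by (rule poly_subst_superset) (use Poly_Mapping.keys_add[of p q] in auto)
  then show ?thesis
    by (simp add: poly_subst_superset[of ?A] lookup_add algebra_simps sum.distrib)
qed

lemma poly_subst_0: "poly_subst f 0 = 0"
  by (simp add: poly_subst_def)

lemma poly_subst_diff: "poly_subst f (p - q) = poly_subst f p - poly_subst f q"
  using poly_subst_add[of f "p - q" q] by (simp add: algebra_simps)

lemma poly_subst_sum: "poly_subst f (sum g A) = (\<Sum>x \<in> A. poly_subst f (g x))"
  by (induction A rule: infinite_finite_induct) (auto simp: poly_subst_0 poly_subst_add)

lemma poly_subst_single: "poly_subst f (Poly_Mapping.single m c) = of_int c * monom_subst f m"
  by (simp add: poly_subst_superset[of "{m}"])

lemma poly_subst_Var: "poly_subst f (Var v) = f v"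
  by (simp add: Var_def poly_subst_single monom_subst_def)

lemma poly_subst_1: "poly_subst f 1 = 1"
  using poly_subst_single[of f 0 1] by (simp add: monom_subst_def)

lemma sum_monomials:
  "(\<Sum>m \<in> Poly_Mapping.keys p. Poly_Mapping.single m (Poly_Mapping.lookup p m)) = p"
proof (rule poly_mapping_eqI)
  fix n
  show "Poly_Mapping.lookup
      (\<Sum>m \<in> Poly_Mapping.keys p. Poly_Mapping.single m (Poly_Mapping.lookup p m)) n =
      Poly_Mapping.lookup p n"
    by (simp add: lookup_sum lookup_single when_def in_keys_iff)
qed

text \<open>Breaks the convolution product into single monomials, so that multiplicativity of
  \<open>poly_subst\<close> follows from its additivity and \<open>monom_subst_add\<close>.\<close>

lemma poly_mult_monomials:
  fixes p q :: "'v ipoly"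
  shows "p * q = (\<Sum>m \<in> Poly_Mapping.keys p. \<Sum>n \<in> Poly_Mapping.keys q.
    Poly_Mapping.single (m + n) (Poly_Mapping.lookup p m * Poly_Mapping.lookup q n))"
proof -
  have "p * q = (\<Sum>m \<in> Poly_Mapping.keys p. Poly_Mapping.single m (Poly_Mapping.lookup p m)) *
      (\<Sum>n \<in> Poly_Mapping.keys q. Poly_Mapping.single n (Poly_Mapping.lookup q n))"
    by (simp only: sum_monomials)
  then show ?thesis
    by (simp add: sum_product mult_single)
qed

lemma poly_subst_mult: "poly_subst f (p * q) = poly_subst f p * poly_subst f q"
proof -
  have "poly_subst f (p * q) = (\<Sum>m \<in> Poly_Mapping.keys p. \<Sum>n \<in> Poly_Mapping.keys q.
      of_int (Poly_Mapping.lookup p m * Poly_Mapping.lookup q n) * monom_subst f (m + n))"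
    by (subst poly_mult_monomials) (simp only: poly_subst_sum poly_subst_single)
  then show ?thesis
    by (simp add: poly_subst_superset[OF finite_keys order_refl] sum_product monom_subst_add
        algebra_simps)
qed

lemma poly_subst_prod: "poly_subst f (prod g A) = (\<Prod>x \<in> A. poly_subst f (g x))"
  by (induction A rule: infinite_finite_induct) (auto simp: poly_subst_1 poly_subst_mult)

subsection \<open>Graham-nonnegative polynomials\<close>

text \<open>The condition on the witness \<open>Q\<close> in \<open>Graham_nonneg\<close>. Closure
  under sums and products is shown for witnesses and transported by the homomorphism
  \<open>poly_subst neg_root\<close>.\<close>

definition root_nonneg :: "nat ipoly \<Rightarrow> bool" where
  "root_nonneg Q \<longleftrightarrow> (\<forall>m. Poly_Mapping.lookup Q m \<ge> 0) \<and>
     (\<forall>m \<in> Poly_Mapping.keys Q. Poly_Mapping.keys m \<subseteq> {1..})"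

lemma Graham_nonneg_iff: "Graham_nonneg p \<longleftrightarrow> (\<exists>Q. root_nonneg Q \<and> p = poly_subst neg_root Q)"
  by (auto simp: Graham_nonneg_def root_nonneg_def)

lemma root_nonneg_0: "root_nonneg 0"
  by (simp add: root_nonneg_def)

lemma root_nonneg_add: "root_nonneg p \<Longrightarrow> root_nonneg q \<Longrightarrow> root_nonneg (p + q)"
  using Poly_Mapping.keys_add[of p q] unfolding root_nonneg_def lookup_add by fastforce

lemma root_nonneg_sum: "(\<And>x. x \<in> A \<Longrightarrow> root_nonneg (g x)) \<Longrightarrow> root_nonneg (sum g A)"
  by (induction A rule: infinite_finite_induct) (auto simp: root_nonneg_0 root_nonneg_add)

lemma root_nonneg_single:
  "c \<ge> 0 \<Longrightarrow> Poly_Mapping.keys m \<subseteq> {1..} \<Longrightarrow> root_nonneg (Poly_Mapping.single m c)"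
  by (auto simp: root_nonneg_def lookup_single when_def)

lemma root_nonneg_mult:
  assumes "root_nonneg p" and "root_nonneg q"
  shows "root_nonneg (p * q)"
  unfolding poly_mult_monomials[of p q]
proof (intro root_nonneg_sum root_nonneg_single)
  fix m n assume "m \<in> Poly_Mapping.keys p" "n \<in> Poly_Mapping.keys q"
  then show "Poly_Mapping.keys (m + n) \<subseteq> {1..}"
    using assms Poly_Mapping.keys_add[of m n] unfolding root_nonneg_def by blast
qed (use assms in \<open>auto simp: root_nonneg_def\<close>)

lemma Graham_nonneg_0: "Graham_nonneg 0"
  unfolding Graham_nonneg_iff by (metis root_nonneg_0 poly_subst_0)

lemma Graham_nonneg_1: "Graham_nonneg 1"
proof -
  have "root_nonneg 1"
    using root_nonneg_single[of 1 0] by simp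
  then show ?thesis
    unfolding Graham_nonneg_iff by (metis poly_subst_1)
qed

lemma Graham_nonneg_add: "Graham_nonneg p \<Longrightarrow> Graham_nonneg q \<Longrightarrow> Graham_nonneg (p + q)"
  unfolding Graham_nonneg_iff by (metis root_nonneg_add poly_subst_add)

lemma Graham_nonneg_mult: "Graham_nonneg p \<Longrightarrow> Graham_nonneg q \<Longrightarrow> Graham_nonneg (p * q)"
  unfolding Graham_nonneg_iff by (metis root_nonneg_mult poly_subst_mult)

lemma Graham_nonneg_prod: "(\<And>x. x \<in> A \<Longrightarrow> Graham_nonneg (g x)) \<Longrightarrow> Graham_nonneg (prod g A)"
  by (induction A rule: infinite_finite_induct) (auto simp: Graham_nonneg_1 Graham_nonneg_mult)

lemma Graham_nonneg_neg_root:
  assumes "1 \<le> i" shows "Graham_nonneg (neg_root i)"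
proof -
  have "root_nonneg (Var i)"
    unfolding Var_def by (rule root_nonneg_single) (use assms in auto)
  then show ?thesis
    unfolding Graham_nonneg_iff by (metis poly_subst_Var)
qed

text \<open>The difference telescopes into the negative roots with indices from \<open>j\<close> to
  \<open>a - 1\<close>.\<close>

lemma Graham_nonneg_Var_diff:
  assumes "1 \<le> j" and "j \<le> a"
  shows "Graham_nonneg (Var a - Var j)"
  using assms(2)
proof (induction a rule: dec_induct)
  case base
  then show ?case by (simp add: Graham_nonneg_0)
next
  case (step n)
  have "Graham_nonneg (neg_root n + (Var n - Var j))"
    using step assms(1) by (intro Graham_nonneg_add Graham_nonneg_neg_root) auto
  then show ?case
    by (simp add: neg_root_def)
qed

subsection \<open>Monotonicity along arrows\<close>

definition inversions :: "(nat \<Rightarrow> nat) \<Rightarrow> (nat \<times> nat) set" where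
  "inversions u = {(i, j). 1 \<le> i \<and> i < j \<and> u i > u j}"

text \<open>Let \<open>u\<close> fix everything beyond \<open>N\<close>. An inversion with
  \<open>j > N\<close> would have \<open>u i > j > N\<close>, so \<open>u\<close> fixes
  \<open>u i\<close>; injectivity gives \<open>u i = i < j\<close>, a contradiction.\<close>

lemma finite_inversions:
  assumes "u \<in> S_inf"
  shows "finite (inversions u)"
proof -
  have inj: "inj u" and fin: "finite {i. u i \<noteq> i}"
    using assms permutes_inj by (auto simp: S_inf_def)
  obtain N where N: "\<And>i. u i \<noteq> i \<Longrightarrow> i \<le> N"
    using fin unfolding finite_nat_set_iff_bounded_le by blast
  have "j \<le> N" if "i < j" "u i > u j" for i j
  proof (rule ccontr)
    assume "\<not> j \<le> N"
    then have uj: "u j = j"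
      using N by blast
    with that(2) \<open>\<not> j \<le> N\<close> have "u (u i) = u i"
      using N[of "u i"] by linarith
    then have "u i = i"
      using inj by (simp add: inj_eq)
    with uj that show False by simp
  qed
  then have "i \<le> N \<and> j \<le> N" if "(i, j) \<in> inversions u" for i j
    using that unfolding inversions_def by (metis (no_types, lifting) case_prodD less_imp_le_nat
        mem_Collect_eq order_trans)
  then have "inversions u \<subseteq> {..N} \<times> {..N}"
    by auto
  then show ?thesis
    by (rule finite_subset) simp
qed

text \<open>Removing a descent cannot create inversions on balance: the inversions of the new
  permutation inject into those of \<open>u\<close>.\<close>

lemma perm_len_transpose_le:
  assumes u: "u \<in> S_inf" and ab: "1 \<le> a" "a < b" and desc: "u b < u a"
  shows "perm_len (u \<circ> transpose a b) \<le> perm_len u"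
proof -
  let ?t = "transpose a b"
  \<comment> \<open>If the transposition reverses a pair \<open>i < j\<close>, then
    \<open>i = a\<close> and \<open>j \<le> b\<close>, or \<open>j = b\<close> and
    \<open>a \<le> i\<close>. The pair \<open>(a, b)\<close> is no inversion of the new permutation,
    and in the other cases comparison through \<open>u b < u a\<close> shows that
    \<open>(i, j)\<close> itself is already an inversion of \<open>u\<close>.\<close>
  define \<phi> where "\<phi> = (\<lambda>(i, j). if ?t i < ?t j then (?t i, ?t j) else (i, j))"
  have "inj_on \<phi> (inversions (u \<circ> ?t))"
  proof (rule inj_onI; clarify)
    fix i j i' j'
    assume "(i, j) \<in> inversions (u \<circ> ?t)" "(i', j') \<in> inversions (u \<circ> ?t)" "\<phi> (i, j) = \<phi> (i', j')"
    then have lt: "i < j" "i' < j'"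
      and eq: "(if ?t i < ?t j then (?t i, ?t j) else (i, j)) =
        (if ?t i' < ?t j' then (?t i', ?t j') else (i', j'))"
      by (simp_all add: inversions_def \<phi>_def)
    show "i = i' \<and> j = j'"
    proof (cases "?t i < ?t j \<longleftrightarrow> ?t i' < ?t j'")
      case True
      with eq have "(?t i, ?t j) = (?t i', ?t j') \<or> (i, j) = (i', j')"
        by (simp split: if_splits)
      then show ?thesis
        by (metis transpose_involutory prod.inject)
    next
      case False
      with eq have "(?t i, ?t j) = (i', j') \<or> (i, j) = (?t i', ?t j')"
        by (simp split: if_splits)
      \<comment> \<open>The transposition is an involution, so each pair is the image of the other.
        Both pairs are increasing, so it preserves the order of both, contrary to the case
        assumption.\<close>
      then have "(?t i, ?t j) = (i', j') \<and> (?t i', ?t j') = (i, j)"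
        by (metis transpose_involutory prod.inject)
      with False lt show ?thesis by simp
    qed
  qed
  moreover have "\<phi> ` inversions (u \<circ> ?t) \<subseteq> inversions u"
  proof (rule image_subsetI; clarify)
    fix i j
    assume "(i, j) \<in> inversions (u \<circ> ?t)"
    then have "1 \<le> i" "i < j" "u (?t j) < u (?t i)"
      by (auto simp: inversions_def)
    then show "\<phi> (i, j) \<in> inversions u"
      using ab desc
      by (cases "i = a"; cases "i = b"; cases "j = a"; cases "j = b")
        (auto simp: \<phi>_def inversions_def)
  qed
  ultimately have "card (inversions (u \<circ> ?t)) \<le> card (inversions u)"
    using card_inj_on_le finite_inversions[OF u] by blast
  then show ?thesis
    by (simp add: perm_len_def inversions_def)
qed

lemma S_inf_comp_transpose:
  assumes "u \<in> S_inf" and "1 \<le> a" "1 \<le> b"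
  shows "u \<circ> transpose a b \<in> S_inf"
proof -
  have "{i. (u \<circ> transpose a b) i \<noteq> i} \<subseteq> {i. u i \<noteq> i} \<union> {a, b}"
    by (auto simp: transpose_def)
  then show ?thesis
    using assms by (auto simp: S_inf_def permutes_compose permutes_swap_id intro: finite_subset)
qed

lemma perm_len_less_transposeD:
  assumes "u \<in> S_inf" and "1 \<le> a" "a < b" and "perm_len u < perm_len (u \<circ> transpose a b)"
  shows "u a < u b"
proof -
  have "inj u"
    using assms permutes_inj by (auto simp: S_inf_def)
  then have "u a \<noteq> u b"
    using assms by (metis injD less_irrefl)
  moreover have "\<not> u b < u a"
    using perm_len_transpose_le[OF assms(1-3)] assms(4) by fastforce
  ultimately show ?thesis by simp
qed

text \<open>Each factor raises the length, so it moves a larger value to position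
  \<open>a \<le> k\<close> and a smaller one to \<open>b > k\<close>. A position
  \<open>i \<le> k\<close> is never \<open>b\<close>, hence it cannot lose. Membership in
  \<open>S_inf\<close> is carried along because the length comparison needs it.\<close>

lemma mult_transps_mono:
  assumes "u \<in> S_inf"
    and "\<forall>(a, b) \<in> set ts. 1 \<le> a \<and> a \<le> k \<and> k < b"
    and "\<forall>i \<in> {1..length ts}. perm_len (mult_transps u (take i ts)) = perm_len u + i"
    and "i \<le> k"
  shows "mult_transps u ts \<in> S_inf \<and> u i \<le> mult_transps u ts i"
  using assms(2,3)
proof (induction ts rule: rev_induct)
  case Nil
  then show ?case using assms(1) by (simp add: mult_transps_def)
next
  case (snoc x ts)
  obtain a b where x: "x = (a, b)" by force
  let ?v = "mult_transps u ts"
  have ab: "1 \<le> a" "a \<le> k" "k < b"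
    using snoc.prems(1) x by auto
  have len: "\<forall>i \<in> {1..length ts}. perm_len (mult_transps u (take i ts)) = perm_len u + i"
  proof
    fix i assume "i \<in> {1..length ts}"
    then show "perm_len (mult_transps u (take i ts)) = perm_len u + i"
      using snoc.prems(2)[rule_format, of i] by simp
  qed
  then have v: "?v \<in> S_inf" "u i \<le> ?v i"
    using snoc by auto
  have eq: "mult_transps u (ts @ [x]) = ?v \<circ> transpose a b"
    by (simp add: mult_transps_def x)
  \<comment> \<open>The length hypothesis starts at index 1, so the empty prefix is treated
    separately.\<close>
  have "perm_len ?v = perm_len u + length ts"
  proof (cases "ts = []")
    case False
    then show ?thesis
      using len[rule_format, of "length ts"] by (simp add: Suc_le_eq)
  qed (simp add: mult_transps_def)
  moreover have "perm_len (mult_transps u (ts @ [x])) = perm_len u + Suc (length ts)"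
    using snoc.prems(2) by (auto dest!: bspec[of _ _ "Suc (length ts)"])
  ultimately have "?v a < ?v b"
    using ab v perm_len_less_transposeD eq by simp
  then have "?v i \<le> (?v \<circ> transpose a b) i"
    using ab assms(4) by (auto simp: transpose_def)
  then show ?case
    unfolding eq using v ab S_inf_comp_transpose[of ?v a b] by (meson le_less_trans less_imp_le order_trans)
qed

lemma arrow_mono:
  assumes "arrow k u v" and "i \<le> k"
  shows "u i \<le> v i"
  using assms mult_transps_mono unfolding arrow_def by blast

subsection \<open>Weights of paths\<close>

lemma S_inf_ge_1: "u \<in> S_inf \<Longrightarrow> 1 \<le> i \<Longrightarrow> 1 \<le> u i"
  using permutes_in_image[of u "{1..}" i] by (auto simp: S_inf_def)

lemma subst_path_weight:
  "subst_z_y (path_weight lam us) =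
    (\<Prod>j = 1..length lam. \<Prod>a \<in> P_set (lam ! (j - 1)) (us ! (j - 1)) (us ! j). Var a - Var j)"
  by (simp add: subst_z_y_def path_weight_def step_weight_def poly_subst_prod poly_subst_diff
      poly_subst_Var)

lemma finite_P_set: "finite (P_set k u w)"
  by (rule finite_subset[of _ "u ` {..k}"]) (auto simp: P_set_def)

text \<open>A discrete crossing argument: the value at a fixed position starts above the step number
  and ends at or below it, and being weakly increasing it must meet it exactly, without moving in
  that step.\<close>

lemma small_value_vanishing_factor:
  assumes part: "is_partition lam" and path: "us \<in> Path lam u w"
    and j: "1 \<le> j" "j \<le> length lam"
    and a: "a \<in> P_set (lam ! (j - 1)) (us ! (j - 1)) (us ! j)" "a < j"
  shows "\<exists>s \<in> {1..length lam}. s \<in> P_set (lam ! (s - 1)) (us ! (s - 1)) (us ! s)"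
proof -
  obtain i where i: "1 \<le> i" "i \<le> lam ! (j - 1)" "a = (us ! (j - 1)) i" "(us ! j) i = a"
    using a(1) by (auto simp: P_set_def)
  \<comment> \<open>The index \<open>j\<close> qualifies, so the least one exists and does not
    exceed \<open>j\<close>.\<close>
  define s where "s = (LEAST s. (us ! s) i \<le> s)"
  have "(us ! j) i \<le> j"
    using i(4) a(2) by simp
  then have s: "(us ! s) i \<le> s" "s \<le> j"
    unfolding s_def by (rule LeastI, rule Least_le)
  have "us ! 0 \<in> S_inf"
    using path by (auto simp: Path_def)
  then have "s \<noteq> 0"
    using s(1) S_inf_ge_1 i(1) by (metis le_zero_eq not_one_le_zero)
  \<comment> \<open>By minimality the value before step \<open>s\<close> exceeds
    \<open>s - 1\<close>.\<close>
  then have prev: "s \<le> (us ! (s - 1)) i"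
    using not_less_Least[of "s - 1" "\<lambda>s. (us ! s) i \<le> s"] unfolding s_def[symmetric] by auto
  \<comment> \<open>Since \<open>i\<close> lies within the part for step \<open>j\<close>, it lies
    within the earlier, larger part for step \<open>s\<close>, so \<open>arrow_mono\<close> applies
    there.\<close>
  have "lam ! (j - 1) \<le> lam ! (s - 1)"
  proof (cases "s = j")
    case False
    then show ?thesis
      using part s(2) j \<open>s \<noteq> 0\<close> unfolding is_partition_def
      by (auto intro!: sorted_wrt_nth_less[of "(\<ge>)"])
  qed simp
  then have il: "i \<le> lam ! (s - 1)"
    using i(2) by simp
  have "s \<in> {1..length lam}"
    using \<open>s \<noteq> 0\<close> s(2) j(2) by auto
  moreover from this have "(us ! (s - 1)) i \<le> (us ! s) i"
    using path il arrow_mono[of "lam ! (s - 1)" "us ! (s - 1)" "us ! s" i]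
    by (simp add: Path_def)
  then have "(us ! (s - 1)) i = s" "(us ! s) i = s"
    using prev s(1) by linarith+
  then have "s \<in> P_set (lam ! (s - 1)) (us ! (s - 1)) (us ! s)"
    unfolding P_set_def using i(1) il by force
  ultimately show ?thesis by blast
qed

theorem theorem6p1:
  fixes u w :: "nat \<Rightarrow> nat"
    and lam :: "nat list"
    and P :: "(nat \<Rightarrow> nat) list"
  assumes "u \<in> S_inf" and "w \<in> S_inf"
    and "is_partition lam"
    and "P \<in> Path lam u w"
  shows "Graham_nonneg (subst_z_y (path_weight lam P))"
proof (cases "\<exists>s \<in> {1..length lam}. s \<in> P_set (lam ! (s - 1)) (P ! (s - 1)) (P ! s)")
  case True
  then have "subst_z_y (path_weight lam P) = 0"
    unfolding subst_path_weight by (force simp: finite_P_set intro!: prod_zero)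
  then show ?thesis
    by (simp add: Graham_nonneg_0)
next
  case False
  show ?thesis
    unfolding subst_path_weight
  proof (intro Graham_nonneg_prod Graham_nonneg_Var_diff)
    fix j a
    assume j: "j \<in> {1..length lam}" and a: "a \<in> P_set (lam ! (j - 1)) (P ! (j - 1)) (P ! j)"
    show "1 \<le> j" using j by simp
    \<comment> \<open>A smaller \<open>a\<close> would force a factor \<open>Var s - Var s\<close>,
      which this case excludes.\<close>
    show "j \<le> a"
      using small_value_vanishing_factor[OF assms(3,4) _ _ a] j False by fastforce
  qed
qed

end
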